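(* Let $A(x,y,z)$ be the generating function in which, for $0\le r\le n$, the coefficient of $x^ry^dz^n$ is the number of Schröder trees with $n+1$ leaves whose $r$th leaf has depth $d$. Then $$A(x,y,z)=\frac{1}{1+y-\dfrac{y}{(1-\tilde S(z))(1-\tilde S(xz))}}.$$
   Context: A plane tree is a rooted tree where the children of each node are linearly ordered. A Schröder tree is a plane tree where every internal (non-leaf) node has at least two children (the single-node tree is allowed and has one leaf). The leaves are ordered from left to right and indexed starting at $0$, so that the leftmost leaf is the $0$th leaf. The depth of a leaf is the number of edges in the path from the root to it. $\tilde S(z)$ denotes the generating function for Schröder trees where $z$ marks the number of leaves; it satisfies $\tilde S(z)=z+\frac{\tilde S(z)^2}{1-\tilde S(z)}$ and equals $$\tilde S(z)=\frac{1+z-\sqrt{1-6z+z^2}}{4}.$$ *)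

theory Defs
  imports "HOL-Computational_Algebra.Formal_Power_Series"
begin

unbundle fps_syntax

datatype plane_tree = Node (children: "plane_tree list")

fun schroeder_tree :: "plane_tree \<Rightarrow> bool" where
  "schroeder_tree (Node ts) \<longleftrightarrow>
     (ts = [] \<or> 2 \<le> length ts) \<and> (\<forall>t \<in> set ts. schroeder_tree t)"

text \<open>The depths of the leaves, listed from the leftmost leaf to the rightmost one. As lists
  are indexed from 0, \<open>leaf_depths t ! r\<close> is the depth of the \<open>r\<close>th leaf.\<close>

fun leaf_depths :: "plane_tree \<Rightarrow> nat list" where
  "leaf_depths (Node ts) =
     (if ts = [] then [0] else map Suc (concat (map leaf_depths ts)))"

definition num_leaves :: "plane_tree \<Rightarrow> nat" where
  "num_leaves t = length (leaf_depths t)"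

text \<open>The coefficient ring is left open, so that the series can be used both over a field and
  over a ring of power series in the other indeterminates.\<close>

definition schroeder_gf :: "'a::semiring_1 fps" where
  "schroeder_gf = Abs_fps (\<lambda>n. of_nat (card {t. schroeder_tree t \<and> num_leaves t = n}))"

text \<open>Power series in \<open>x\<close>, \<open>y\<close>, \<open>z\<close> are iterated: the outermost indeterminate is \<open>z\<close>, the middle
  one \<open>y\<close>, and the innermost one \<open>x\<close>. Hence the coefficient of \<open>x\<^sup>r y\<^sup>d z\<^sup>n\<close> in \<open>F\<close> is
  \<open>F $ n $ d $ r\<close>.\<close>

type_synonym fps3 = "rat fps fps fps"

definition var_x :: fps3 where "var_x = fps_const (fps_const fps_X)"
definition var_y :: fps3 where "var_y = fps_const fps_X"
definition var_z :: fps3 where "var_z = fps_X"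

definition leaf_depth_gf :: fps3 where
  "leaf_depth_gf = Abs_fps (\<lambda>n. Abs_fps (\<lambda>d. Abs_fps (\<lambda>r.
     of_nat (card {t. schroeder_tree t \<and> num_leaves t = n + 1 \<and> r \<le> n \<and> leaf_depths t ! r = d}))))"

text \<open>The counting above uses \<^const>\<open>card\<close>, which is meaningful because the sets are finite.\<close>

lemma leaf_depths_nonempty: "leaf_depths t \<noteq> []"
proof (induction t)
  case (Node ts)
  then show ?case by (cases ts) auto
qed

lemma length_le_num_leaves: "length ts \<le> (\<Sum>t\<leftarrow>ts. num_leaves t)"
proof (induction ts)
  case (Cons t ts)
  have "1 \<le> num_leaves t"
    using leaf_depths_nonempty[of t] by (cases "leaf_depths t") (auto simp: num_leaves_def)
  with Cons show ?case by simp
qed simp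

lemma num_leaves_Node:
  "ts \<noteq> [] \<Longrightarrow> num_leaves (Node ts) = (\<Sum>t\<leftarrow>ts. num_leaves t)"
  by (simp add: num_leaves_def length_concat comp_def)

lemma finite_schroeder_trees_le: "finite {t. schroeder_tree t \<and> num_leaves t \<le> n}"
proof (induction n)
  case 0
  then show ?case using leaf_depths_nonempty by (simp add: num_leaves_def)
next
  case (Suc n)
  let ?A = "{t. schroeder_tree t \<and> num_leaves t \<le> n}"
  let ?L = "{ts. set ts \<subseteq> ?A \<and> length ts \<le> Suc n}"
  have "{t. schroeder_tree t \<and> num_leaves t \<le> Suc n} \<subseteq> Node ` ?L"
  proof
    fix t assume t: "t \<in> {t. schroeder_tree t \<and> num_leaves t \<le> Suc n}"
    obtain ts where ts: "t = Node ts" by (cases t)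
    have "ts \<in> ?L"
    proof (cases "ts = []")
      case False
      have sum: "(\<Sum>t\<leftarrow>ts. num_leaves t) \<le> Suc n"
        using t ts num_leaves_Node[OF False] by auto
      have "num_leaves s \<le> n" if s: "s \<in> set ts" for s
      proof -
        obtain us vs where split: "ts = us @ s # vs" using split_list[OF s] by blast
        have "2 \<le> length ts" using t ts False by auto
        then have "1 \<le> length us + length vs" using split by simp
        then show ?thesis
          using sum split length_le_num_leaves[of us] length_le_num_leaves[of vs] by simp
      qed
      moreover have "\<forall>s \<in> set ts. schroeder_tree s" using t ts by auto
      moreover have "length ts \<le> Suc n" using length_le_num_leaves[of ts] sum by simp
      ultimately show ?thesis by auto
    qed simp
    then show "t \<in> Node ` ?L" using ts by blast
  qed
  moreover have "finite ?L" using finite_lists_length_le[OF Suc.IH] .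
  ultimately show ?case by (meson finite_imageI finite_subset)
qed

text \<open>Division on nested power series is only the syntactic operation of \<^typ>\<open>'a fps\<close>, as the
  coefficients do not form a field. It is the true quotient whenever the denominator has
  \<open>z\<close>-constant term 1, as all denominators built from the series above have.\<close>

lemma fps3_divide_mult_cancel:
  fixes f g :: fps3
  assumes "g $ 0 = 1"
  shows "f / g * g = f"
proof -
  have inv1: "inverse (1 :: rat fps fps) = 1"
    by (rule fps_inverse_one') (simp add: fps_inverse_one)
  have "inverse g = fps_right_inverse g 1"
    by (simp only: fps_inverse_def[of g] assms inv1)
  then have "g * inverse g = 1"
    using fps_right_inverse[of g 1] assms by simp
  moreover have "f / g = f * inverse g"
    using assms by (intro fps_divide_unit) simp
  ultimately show ?thesis by (simp add: mult.assoc mult.commute[of "inverse g"])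
qed

end

theory Submission
  imports Defs
begin

text \<open>
  Give a leaf with index \<open>r\<close> and depth \<open>d\<close> the weight \<open>x\<^sup>r y\<^sup>d\<close>, and let the weight of a tree, or of
  a forest (a list of trees), be the sum over all its leaves, where in a forest the indices run
  through from left to right. This weight is a polynomial that depends on the list of leaf depths
  only (\<open>depth_poly\<close>), and it behaves well under the two operations that build trees: moving a
  forest one level down multiplies the weight by \<open>y\<close>, and appending a list of depths \<open>es\<close> to \<open>ds\<close>
  adds the weight of \<open>es\<close>, multiplied by \<open>x\<close> to the length of \<open>ds\<close>. Working with whole polynomials
  thus replaces bijections between trees with a marked leaf by polynomial identities.

  Let \<open>B\<close> and \<open>F\<close> be the generating functions of trees and of forests with these weights, with \<open>z\<close>
  marking all leaves, so that \<open>B = z A\<close>, and let \<open>S\<close> be the series of Schroeder trees. Splitting off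
  the first tree of a forest gives \<open>F = B / (1 - S(z)) + S(x z) F\<close>: either the leaf lies in the
  first tree and the other trees form any forest, or it lies in a later tree and its index is
  shifted by the number of leaves of the first one. Hence \<open>F (1 - S(z)) (1 - S(x z)) = B\<close>
  (\<open>pointed_forest_gf_eq\<close>). Splitting at the root gives \<open>B = z + y (F - B)\<close>, since the subtrees of
  an internal node form an arbitrary nonempty forest that does not consist of a single tree
  (\<open>weight_gf_trees\<close>). Eliminating \<open>F\<close> and cancelling \<open>z\<close> yields the formula for \<open>A\<close>.
\<close>

section \<open>Weighted generating functions\<close>

text \<open>The coefficients are finite sums only if \<open>s\<close> takes every value finitely often on \<open>C\<close>; the
  lemmas below assume this where it matters. The weights carry the other indeterminates.\<close>

definition weight_gf :: "'b set \<Rightarrow> ('b \<Rightarrow> nat) \<Rightarrow> ('b \<Rightarrow> 'a::comm_ring_1) \<Rightarrow> 'a fps" where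
  "weight_gf C s w = Abs_fps (\<lambda>n. \<Sum>c | c \<in> C \<and> s c = n. w c)"

lemma weight_gf_cong:
  assumes "\<And>c. c \<in> C \<Longrightarrow> v c = w c" "\<And>c. c \<in> C \<Longrightarrow> s c = t c"
  shows "weight_gf C s v = weight_gf C t w"
  unfolding weight_gf_def using assms
  by (intro arg_cong[where f = Abs_fps] ext sum.cong) auto

lemma weight_gf_singleton: "weight_gf {c} s w = fps_const (w c) * fps_X ^ s c"
proof (rule fps_ext)
  fix n
  have "{c'. c' = c \<and> s c' = n} = (if s c = n then {c} else {})" by auto
  then show "weight_gf {c} s w $ n = (fps_const (w c) * fps_X ^ s c) $ n"
    by (simp add: weight_gf_def fps_X_power_nth)
qed

lemma weight_gf_image:
  assumes "inj_on f C"
  shows "weight_gf (f ` C) s w = weight_gf C (s \<circ> f) (w \<circ> f)"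
proof (rule fps_ext)
  fix n
  have "{c. c \<in> f ` C \<and> s c = n} = f ` {c. c \<in> C \<and> (s \<circ> f) c = n}" by auto
  moreover have "inj_on f {c. c \<in> C \<and> (s \<circ> f) c = n}"
    using assms by (rule inj_on_subset) auto
  ultimately show "weight_gf (f ` C) s w $ n = weight_gf C (s \<circ> f) (w \<circ> f) $ n"
    by (simp add: weight_gf_def sum.reindex)
qed

lemma weight_gf_Un:
  assumes "\<And>n. finite {c. c \<in> C \<and> s c = n}" "\<And>n. finite {c. c \<in> D \<and> s c = n}" "C \<inter> D = {}"
  shows "weight_gf (C \<union> D) s w = weight_gf C s w + weight_gf D s w"
proof (rule fps_ext)
  fix n
  have "{c. c \<in> C \<union> D \<and> s c = n} = {c. c \<in> C \<and> s c = n} \<union> {c. c \<in> D \<and> s c = n}" by auto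
  moreover have "{c. c \<in> C \<and> s c = n} \<inter> {c. c \<in> D \<and> s c = n} = {}" using assms(3) by auto
  ultimately show "weight_gf (C \<union> D) s w $ n = (weight_gf C s w + weight_gf D s w) $ n"
    by (simp add: weight_gf_def sum.union_disjoint assms)
qed

lemma weight_gf_add:
  "weight_gf C s (\<lambda>c. v c + w c) = weight_gf C s v + weight_gf C s w"
  by (rule fps_ext) (simp add: weight_gf_def sum.distrib)

lemma weight_gf_scale:
  "weight_gf C s (\<lambda>c. a * w c) = fps_const a * weight_gf C s w"
  by (rule fps_ext) (simp add: weight_gf_def sum_distrib_left)

lemma weight_gf_Times:
  assumes C: "\<And>n. finite {c. c \<in> C \<and> s c = n}" and D: "\<And>n. finite {d. d \<in> D \<and> t d = n}"
  shows "weight_gf (C \<times> D) (\<lambda>(c, d). s c + t d) (\<lambda>(c, d). v c * w d)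
    = weight_gf C s v * weight_gf D t w"
proof (rule fps_ext)
  fix n
  let ?C = "\<lambda>i. {c. c \<in> C \<and> s c = i}" and ?D = "\<lambda>i. {d. d \<in> D \<and> t d = i}"
  have "{p. p \<in> C \<times> D \<and> (case p of (c, d) \<Rightarrow> s c + t d) = n}
      = (\<Union>i\<in>{0..n}. ?C i \<times> ?D (n - i))"
    by auto
  then have "weight_gf (C \<times> D) (\<lambda>(c, d). s c + t d) (\<lambda>(c, d). v c * w d) $ n
      = (\<Sum>p\<in>(\<Union>i\<in>{0..n}. ?C i \<times> ?D (n - i)). case p of (c, d) \<Rightarrow> v c * w d)"
    by (simp add: weight_gf_def)
  also have "\<dots> = (\<Sum>i=0..n. \<Sum>p\<in>?C i \<times> ?D (n - i). case p of (c, d) \<Rightarrow> v c * w d)"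
    using C D by (intro sum.UNION_disjoint) auto
  also have "\<dots> = (\<Sum>i=0..n. (\<Sum>c\<in>?C i. v c) * (\<Sum>d\<in>?D (n - i). w d))"
    by (simp add: sum_product sum.cartesian_product)
  finally show "weight_gf (C \<times> D) (\<lambda>(c, d). s c + t d) (\<lambda>(c, d). v c * w d) $ n
      = (weight_gf C s v * weight_gf D t w) $ n"
    by (simp add: weight_gf_def fps_mult_nth)
qed

section \<open>The depth polynomial of a list of leaf depths\<close>

fun depth_poly :: "'a::comm_ring_1 \<Rightarrow> 'a \<Rightarrow> nat list \<Rightarrow> 'a" where
  "depth_poly x y [] = 0"
| "depth_poly x y (d # ds) = y ^ d + x * depth_poly x y ds"

lemma depth_poly_append:
  "depth_poly x y (ds @ es) = depth_poly x y ds + x ^ length ds * depth_poly x y es"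
  by (induction ds) (simp_all add: algebra_simps)

lemma depth_poly_map_Suc: "depth_poly x y (map Suc ds) = y * depth_poly x y ds"
  by (induction ds) (simp_all add: algebra_simps)

text \<open>With the indeterminates as arguments, the polynomial records exactly which leaf has which
  depth. This links it to the counting of trees.\<close>

lemma depth_poly_nth:
  "depth_poly (fps_const fps_X) fps_X ds $ d $ r
    = (if r < length ds \<and> ds ! r = d then 1 else 0 :: 'a::comm_ring_1)"
proof (induction ds arbitrary: r)
  case (Cons e ds)
  then show ?case by (cases r) (auto simp: fps_X_power_nth)
qed simp

section \<open>Schroeder trees and forests\<close>

abbreviation schroeder_trees :: "plane_tree set" where
  "schroeder_trees \<equiv> Collect schroeder_tree"

abbreviation forest_depths :: "plane_tree list \<Rightarrow> nat list" where
  "forest_depths ts \<equiv> concat (map leaf_depths ts)"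

definition forest_leaves :: "plane_tree list \<Rightarrow> nat" where
  "forest_leaves ts = length (forest_depths ts)"

lemma forest_leaves_simps [simp]:
  "forest_leaves [] = 0"
  "forest_leaves (t # ts) = num_leaves t + forest_leaves ts"
  by (simp_all add: forest_leaves_def num_leaves_def)

lemma num_leaves_pos: "0 < num_leaves t"
  using leaf_depths_nonempty[of t] by (simp add: num_leaves_def)

lemma finite_trees: "finite {t. t \<in> schroeder_trees \<and> num_leaves t = n}"
  by (rule finite_subset[OF _ finite_schroeder_trees_le[of n]]) auto

lemma length_le_forest_leaves: "length ts \<le> forest_leaves ts"
proof (induction ts)
  case (Cons t ts)
  then show ?case using num_leaves_pos[of t] by simp
qed simp

lemma num_leaves_le_forest_leaves: "t \<in> set ts \<Longrightarrow> num_leaves t \<le> forest_leaves ts"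
  by (induction ts) auto

lemma finite_forests: "finite {ts. ts \<in> lists schroeder_trees \<and> forest_leaves ts = n}"
  by (rule finite_subset[OF _ finite_lists_length_le[OF finite_schroeder_trees_le[of n], of n]])
     (auto simp: length_le_forest_leaves num_leaves_le_forest_leaves)

text \<open>A forest is empty or consists of a first tree and a remaining forest.\<close>

lemma weight_gf_forests:
  fixes w :: "plane_tree list \<Rightarrow> 'a::comm_ring_1"
  shows "weight_gf (lists schroeder_trees) forest_leaves w = fps_const (w []) +
    weight_gf (schroeder_trees \<times> lists schroeder_trees)
      (\<lambda>(t, ts). num_leaves t + forest_leaves ts) (\<lambda>(t, ts). w (t # ts))"
proof -
  let ?T = schroeder_trees and ?cons = "\<lambda>(t, ts). t # ts"
  have split: "lists ?T = {[]} \<union> ?cons ` (?T \<times> lists ?T)"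
  proof (intro set_eqI)
    fix ts
    show "ts \<in> lists ?T \<longleftrightarrow> ts \<in> {[]} \<union> ?cons ` (?T \<times> lists ?T)"
      by (cases ts) (auto simp: image_iff)
  qed
  have "weight_gf ({[]} \<union> ?cons ` (?T \<times> lists ?T)) forest_leaves w
      = weight_gf {[]} forest_leaves w + weight_gf (?cons ` (?T \<times> lists ?T)) forest_leaves w"
    by (rule weight_gf_Un; (rule finite_subset[OF _ finite_forests])?) auto
  also have "weight_gf (?cons ` (?T \<times> lists ?T)) forest_leaves w
      = weight_gf (?T \<times> lists ?T) (forest_leaves \<circ> ?cons) (w \<circ> ?cons)"
    by (rule weight_gf_image) (auto simp: inj_on_def)
  also have "\<dots> = weight_gf (?T \<times> lists ?T)
      (\<lambda>(t, ts). num_leaves t + forest_leaves ts) (\<lambda>(t, ts). w (t # ts))"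
    by (rule weight_gf_cong) auto
  finally show ?thesis
    unfolding split[symmetric] by (simp add: weight_gf_singleton)
qed

text \<open>The subtrees of an internal node form a forest of at least two trees. Such forests are all
  forests except the empty one, which has weight 0 by assumption, and the forests of a single
  tree, which are subtracted as a sum over trees. The \<^const>\<open>Suc\<close> accounts for the edge from the
  root.\<close>

lemma weight_gf_trees:
  fixes w :: "nat list \<Rightarrow> 'a::comm_ring_1"
  assumes "w [] = 0"
  shows "weight_gf schroeder_trees num_leaves (w \<circ> leaf_depths) = fps_const (w [0]) * fps_X
    + weight_gf (lists schroeder_trees) forest_leaves (w \<circ> map Suc \<circ> forest_depths)
    - weight_gf schroeder_trees num_leaves (w \<circ> map Suc \<circ> leaf_depths)"
proof -
  let ?T = schroeder_trees and ?w = "w \<circ> map Suc \<circ> forest_depths"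
  define H where "H = {ts \<in> lists ?T. 2 \<le> length ts}"
  have fin_H: "finite {ts. ts \<in> H \<and> forest_leaves ts = n}" for n
    by (rule finite_subset[OF _ finite_forests[of n]]) (auto simp: H_def)
  have leaves: "num_leaves (Node ts) = forest_leaves ts" if "2 \<le> length ts" for ts
    using that by (auto simp: num_leaves_def forest_leaves_def)
  have trees: "?T = {Node []} \<union> Node ` H"
  proof (intro set_eqI)
    fix t
    obtain ts where "t = Node ts" by (cases t)
    then show "t \<in> ?T \<longleftrightarrow> t \<in> {Node []} \<union> Node ` H"
      by (auto simp: H_def lists_eq_set)
  qed
  have forests: "lists ?T = {[]} \<union> ((\<lambda>t. [t]) ` ?T \<union> H)"
  proof (intro set_eqI)
    fix ts :: "plane_tree list"
    consider "ts = []" | t where "ts = [t]" | "2 \<le> length ts"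
      by (cases ts; cases "tl ts") auto
    then show "ts \<in> lists ?T \<longleftrightarrow> ts \<in> {[]} \<union> ((\<lambda>t. [t]) ` ?T \<union> H)"
      by cases (auto simp: H_def)
  qed
  have "weight_gf ({Node []} \<union> Node ` H) num_leaves (w \<circ> leaf_depths)
      = weight_gf {Node []} num_leaves (w \<circ> leaf_depths)
        + weight_gf (Node ` H) num_leaves (w \<circ> leaf_depths)"
    by (rule weight_gf_Un; (rule finite_subset[OF _ finite_trees])?) (auto simp: H_def)
  also have "weight_gf {Node []} num_leaves (w \<circ> leaf_depths) = fps_const (w [0]) * fps_X"
    by (simp add: weight_gf_singleton num_leaves_def)
  also have "weight_gf (Node ` H) num_leaves (w \<circ> leaf_depths)
      = weight_gf H (num_leaves \<circ> Node) (w \<circ> leaf_depths \<circ> Node)"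
    by (simp add: weight_gf_image inj_on_def comp_assoc)
  also have "\<dots> = weight_gf H forest_leaves ?w"
    by (rule weight_gf_cong) (auto simp: H_def leaves)
  finally have T: "weight_gf ?T num_leaves (w \<circ> leaf_depths)
      = fps_const (w [0]) * fps_X + weight_gf H forest_leaves ?w"
    unfolding trees[symmetric] .
  have "weight_gf ({[]} \<union> ((\<lambda>t. [t]) ` ?T \<union> H)) forest_leaves ?w
      = weight_gf {[]} forest_leaves ?w + weight_gf ((\<lambda>t. [t]) ` ?T \<union> H) forest_leaves ?w"
    by (rule weight_gf_Un; (rule finite_subset[OF _ finite_forests])?) (auto simp: H_def)
  also have "weight_gf ((\<lambda>t. [t]) ` ?T \<union> H) forest_leaves ?w
      = weight_gf ((\<lambda>t. [t]) ` ?T) forest_leaves ?w + weight_gf H forest_leaves ?w"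
    by (rule weight_gf_Un; (rule finite_subset[OF _ finite_forests])?) (auto simp: H_def)
  also have "weight_gf ((\<lambda>t. [t]) ` ?T) forest_leaves ?w
      = weight_gf ?T num_leaves (w \<circ> map Suc \<circ> leaf_depths)"
    by (subst weight_gf_image) (auto simp: inj_on_def comp_def intro!: weight_gf_cong)
  also have "weight_gf {[]} forest_leaves ?w = 0"
    by (simp add: weight_gf_singleton assms)
  finally have "weight_gf (lists ?T) forest_leaves ?w
      = weight_gf ?T num_leaves (w \<circ> map Suc \<circ> leaf_depths) + weight_gf H forest_leaves ?w"
    unfolding forests[symmetric] add_0_left .
  then show ?thesis using T by simp
qed

section \<open>The functional equation\<close>

text \<open>Substituting \<open>x z\<close> for \<open>z\<close> amounts to weighting a tree by \<open>x\<close> to the number of its leaves, which is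
  the shift of the leaf indices caused by a tree that stands further to the left.\<close>

lemma schroeder_gf_compose:
  "schroeder_gf oo (fps_const x * fps_X)
    = weight_gf schroeder_trees num_leaves (\<lambda>t. (x::'a::comm_ring_1) ^ num_leaves t)"
  unfolding fps_compose_linear
  by (rule fps_ext) (simp add: schroeder_gf_def weight_gf_def mult.commute)

text \<open>Forests are sequences of trees, hence their series is \<open>1 / (1 - S(z))\<close>; the statement avoids
  the quotient because the coefficients need not form a field.\<close>

lemma forest_gf_eq:
  shows "weight_gf (lists schroeder_trees) forest_leaves (\<lambda>ts. 1)
    * (1 - (schroeder_gf oo fps_X)) = (1 :: 'a::comm_ring_1 fps)"
proof -
  let ?L = "weight_gf (lists schroeder_trees) forest_leaves (\<lambda>ts. 1) :: 'a fps"
  have "?L = 1 + weight_gf (schroeder_trees \<times> lists schroeder_trees)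
      (\<lambda>(t, ts). num_leaves t + forest_leaves ts) (\<lambda>(t, ts). 1 * 1)"
    by (subst weight_gf_forests) simp
  also have "\<dots> = 1 + weight_gf schroeder_trees num_leaves (\<lambda>t. 1) * ?L"
    by (subst weight_gf_Times) (simp_all add: finite_trees finite_forests del: mem_Collect_eq)
  also have "weight_gf schroeder_trees num_leaves (\<lambda>t. 1) = (schroeder_gf oo fps_X :: 'a fps)"
    using schroeder_gf_compose[of "1::'a"] by simp
  finally show ?thesis by (simp add: algebra_simps)
qed

text \<open>A forest with a distinguished leaf is a tree with a distinguished leaf between two arbitrary
  forests, of which the left one shifts the index of the leaf. Peeling off one tree at a time gives
  a linear equation for the series, which replaces this decomposition.\<close>

lemma pointed_forest_gf_eq:
  fixes x y :: "'a::comm_ring_1"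
  shows "weight_gf (lists schroeder_trees) forest_leaves (depth_poly x y \<circ> forest_depths)
      * ((1 - (schroeder_gf oo fps_X)) * (1 - (schroeder_gf oo (fps_const x * fps_X))))
    = weight_gf schroeder_trees num_leaves (depth_poly x y \<circ> leaf_depths)" (is "?F * (?P * ?Q) = ?B")
proof -
  let ?T = schroeder_trees and ?s = "\<lambda>(t, ts). num_leaves t + forest_leaves ts"
  let ?L = "weight_gf (lists ?T) forest_leaves (\<lambda>ts. 1) :: 'a fps"
  have "?F = weight_gf (?T \<times> lists ?T) ?s
      (\<lambda>(t, ts). depth_poly x y (leaf_depths t) * 1
        + x ^ num_leaves t * depth_poly x y (forest_depths ts))"
    by (subst weight_gf_forests) (simp add: depth_poly_append num_leaves_def)
  also have "\<dots> = weight_gf (?T \<times> lists ?T) ?s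
        (\<lambda>(t, ts). (depth_poly x y \<circ> leaf_depths) t * 1)
      + weight_gf (?T \<times> lists ?T) ?s
        (\<lambda>(t, ts). x ^ num_leaves t * (depth_poly x y \<circ> forest_depths) ts)"
    by (subst weight_gf_add[symmetric]) (auto intro!: weight_gf_cong)
  also have "\<dots> = ?B * ?L + (schroeder_gf oo (fps_const x * fps_X)) * ?F"
    unfolding schroeder_gf_compose
    by (subst weight_gf_Times[OF finite_trees finite_forests])+ simp
  finally have "?F * ?Q = ?B * ?L" by (simp add: algebra_simps)
  then have "?F * (?P * ?Q) = ?B * (?L * ?P)" by (simp add: mult_ac)
  then show ?thesis by (simp only: forest_gf_eq mult_1_right)
qed

lemma tree_gf_functional_equation:
  fixes x y :: "'a::comm_ring_1"
  defines "B \<equiv> weight_gf schroeder_trees num_leaves (depth_poly x y \<circ> leaf_depths)"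
    and "R \<equiv> (1 - (schroeder_gf oo fps_X)) * (1 - (schroeder_gf oo (fps_const x * fps_X)))"
  shows "B * (R + fps_const y * R - fps_const y) = fps_X * R"
proof -
  let ?F = "weight_gf (lists schroeder_trees) forest_leaves (depth_poly x y \<circ> forest_depths)"
  have "depth_poly x y \<circ> map Suc \<circ> g = (\<lambda>c. y * (depth_poly x y \<circ> g) c)"
    for g :: "'b \<Rightarrow> nat list"
    by (auto simp: depth_poly_map_Suc)
  note suc = this
  have "B = fps_X + fps_const y * ?F - fps_const y * B"
    unfolding B_def by (subst weight_gf_trees) (simp_all add: suc weight_gf_scale del: o_apply)
  then have "B * R = fps_X * R + fps_const y * (?F * R) - fps_const y * B * R"
    by (metis (no_types, lifting) left_diff_distrib distrib_right mult.assoc)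
  also have "?F * R = B" unfolding B_def R_def by (rule pointed_forest_gf_eq)
  finally show ?thesis by (simp add: algebra_simps)
qed

text \<open>The factor \<open>z\<close> makes up for the shift by one in \<^const>\<open>leaf_depth_gf\<close>, where \<open>z\<^sup>n\<close> belongs to the
  trees with \<open>n + 1\<close> leaves.\<close>

lemma fps_X_times_leaf_depth_gf:
  "fps_X * leaf_depth_gf = weight_gf schroeder_trees num_leaves
     (depth_poly (fps_const fps_X) fps_X \<circ> leaf_depths)"
proof (intro fps_ext)
  fix n d r
  let ?T = "{t. t \<in> schroeder_trees \<and> num_leaves t = n}"
  have "weight_gf schroeder_trees num_leaves
      (depth_poly (fps_const fps_X) fps_X \<circ> leaf_depths) $ n $ d $ r
    = (\<Sum>t\<in>?T. if r < num_leaves t \<and> leaf_depths t ! r = d then 1 else 0 :: rat)"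
    by (simp add: weight_gf_def fps_sum_nth depth_poly_nth num_leaves_def)
  also have "\<dots> = of_nat (card {t \<in> ?T. r < num_leaves t \<and> leaf_depths t ! r = d})"
    using finite_trees[of n] by (simp add: sum.If_cases Int_def del: mem_Collect_eq) (simp add: conj_ac)
  also have "\<dots> = (fps_X * leaf_depth_gf) $ n $ d $ r"
  proof (cases n)
    case 0
    have "{t \<in> ?T. r < num_leaves t \<and> leaf_depths t ! r = d} = {}" using 0 by auto
    then show ?thesis using 0 by (simp only: card.empty) simp
  next
    case (Suc m)
    have "{t \<in> ?T. r < num_leaves t \<and> leaf_depths t ! r = d}
      = {t. schroeder_tree t \<and> num_leaves t = m + 1 \<and> r \<le> m \<and> leaf_depths t ! r = d}"
      using Suc by auto
    then show ?thesis using Suc by (simp add: leaf_depth_gf_def del: mem_Collect_eq)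
  qed
  finally show "(fps_X * leaf_depth_gf) $ n $ d $ r = weight_gf schroeder_trees num_leaves
     (depth_poly (fps_const fps_X) fps_X \<circ> leaf_depths) $ n $ d $ r" by simp
qed

theorem theorem4p2:
  shows "leaf_depth_gf =
    1 / (1 + var_y -
         var_y / ((1 - (schroeder_gf oo var_z)) * (1 - (schroeder_gf oo (var_x * var_z)))))"
proof -
  define R :: fps3 where
    "R = (1 - (schroeder_gf oo var_z)) * (1 - (schroeder_gf oo (var_x * var_z)))"
  define D where "D = 1 + var_y - var_y / R"
  have "schroeder_gf $ 0 = (0 :: rat fps fps)"
    using num_leaves_pos by (simp add: schroeder_gf_def less_imp_neq[symmetric])
  then have R0: "R $ 0 = 1" by (simp add: R_def)
  then have quotient: "var_y / R * R = var_y" by (rule fps3_divide_mult_cancel)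
  then have "(var_y / R) $ 0 = var_y $ 0"
    using R0 by (metis fps_mult_nth_0 mult.right_neutral)
  then have D0: "D $ 0 = 1" by (simp add: D_def)
  \<comment> \<open>The quotients are formal, so the functional equation is used in a form without division; the
    factors \<open>z\<close>, \<open>R\<close> and \<open>D\<close> can be cancelled because iterated power series over a field form an
    integral domain.\<close>
  have "fps_X * leaf_depth_gf * (R + var_y * R - var_y) = fps_X * R"
    unfolding R_def var_x_def var_y_def var_z_def fps_X_times_leaf_depth_gf
    by (rule tree_gf_functional_equation)
  then have "fps_X * (leaf_depth_gf * (R + var_y * R - var_y)) = fps_X * R"
    by (simp only: mult.assoc)
  then have "leaf_depth_gf * (R + var_y * R - var_y) = R"
    by simp
  also have "R + var_y * R - var_y = D * R"
    unfolding D_def left_diff_distrib distrib_right quotient by simp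
  finally have "(leaf_depth_gf * D) * R = 1 * R" by (simp only: mult.assoc mult_1_left)
  moreover have "R \<noteq> 0" using R0 by auto
  ultimately have "leaf_depth_gf * D = 1" by (metis mult_right_cancel)
  also have "1 = 1 / D * D" using fps3_divide_mult_cancel[OF D0] by simp
  finally have "leaf_depth_gf = 1 / D"
    using D0 by (metis mult_right_cancel fps_zero_nth zero_neq_one)
  then show ?thesis by (simp only: D_def R_def)
qed

end
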